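(* Let $\varphi$ and $\psi$ be bounded analytic functions on the open unit disc $\mathbb{U}$. If $\varphi$ is a covering map, then $\psi(\mathbb{U})\subset\varphi(\mathbb{U})$ implies $T_\varphi\propto T_\psi$.
   Context: $\mathbb{U}$ is the open unit disc in $\mathbb{C}$ and $H^2$ is the Hardy space of $\mathbb{U}$. For a bounded analytic function $\varphi$ on $\mathbb{U}$, $T_\varphi:H^2\to H^2$ is the analytic Toeplitz operator $T_\varphi h=\varphi h$. For bounded linear operators $A,B$ on a Hilbert space $\mathcal{H}$, $A\propto B$ means that there is a nonzero bounded linear operator $X$ on $\mathcal{H}$ with $XA=BX$. "$\varphi$ is a covering map" means that $\varphi:\mathbb{U}\to\varphi(\mathbb{U})$ is a holomorphic (unbranched, topological) covering map of the domain $\varphi(\mathbb{U})$. *)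

theory Defs
  imports "HOL-Complex_Analysis.Complex_Analysis"
begin

section \<open>Intertwining of operators on complex normed spaces\<close>

text \<open>
  The distribution has real normed spaces only, so complex scalars are added on top of them.
\<close>

class complex_normed_vector = real_normed_vector +
  fixes scaleC :: "complex \<Rightarrow> 'a \<Rightarrow> 'a"  (infixr "*\<^sub>C" 75)
  assumes scaleC_add_right: "c *\<^sub>C (x + y) = c *\<^sub>C x + c *\<^sub>C y"
    and scaleC_add_left: "(c + d) *\<^sub>C x = c *\<^sub>C x + d *\<^sub>C x"
    and scaleC_scaleC: "c *\<^sub>C d *\<^sub>C x = (c * d) *\<^sub>C x"
    and scaleC_of_real: "complex_of_real r *\<^sub>C x = r *\<^sub>R x"
    and norm_scaleC: "norm (c *\<^sub>C x) = cmod c * norm x"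

definition bounded_clinear :: "('a::complex_normed_vector \<Rightarrow> 'b::complex_normed_vector) \<Rightarrow> bool"
  where "bounded_clinear X \<longleftrightarrow> bounded_linear X \<and> (\<forall>c f. X (c *\<^sub>C f) = c *\<^sub>C X f)"

definition intertwined ::
    "('a::complex_normed_vector \<Rightarrow> 'a) \<Rightarrow> ('a \<Rightarrow> 'a) \<Rightarrow> bool"  (infix "\<propto>" 50)
  where "A \<propto> B \<longleftrightarrow> (\<exists>X. bounded_clinear X \<and> X \<noteq> (\<lambda>_. 0) \<and> X \<circ> A = B \<circ> X)"


section \<open>The Hardy space of the unit disc\<close>

definition circle_mean :: "(complex \<Rightarrow> complex) \<Rightarrow> real \<Rightarrow> real"
  where "circle_mean f r = integral {0..2*pi} (\<lambda>t. (cmod (f (of_real r * cis t)))\<^sup>2) / (2*pi)"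

text \<open>
  A function on the disc is represented by its extension by \<open>0\<close>, so that equality of
  elements of the type is equality of functions on the disc.
\<close>

typedef hardy2 = "{f :: complex \<Rightarrow> complex. f holomorphic_on ball 0 1 \<and>
    (\<forall>z. z \<notin> ball 0 1 \<longrightarrow> f z = 0) \<and> bdd_above (circle_mean f ` {0..<1})}"
  morphisms fun_of_hardy2 Abs_hardy2
proof
  have "circle_mean (\<lambda>_. 0) r = 0" for r
    by (simp add: circle_mean_def)
  then show "(\<lambda>_. 0) \<in> {f :: complex \<Rightarrow> complex. f holomorphic_on ball 0 1 \<and>
      (\<forall>z. z \<notin> ball 0 1 \<longrightarrow> f z = 0) \<and> bdd_above (circle_mean f ` {0..<1})}"
    by auto
qed

setup_lifting type_definition_hardy2

definition hardy_norm :: "(complex \<Rightarrow> complex) \<Rightarrow> real"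
  where "hardy_norm f = sqrt (SUP r\<in>{0..<1}. circle_mean f r)"

lemma circle_integrable:
  assumes "f holomorphic_on ball 0 1" "0 \<le> r" "r < 1"
  shows "(\<lambda>t. (cmod (f (of_real r * cis t)))\<^sup>2) integrable_on {0..2*pi}"
proof (rule integrable_continuous_real)
  have "(\<lambda>t. of_real r * cis t) ` {0..2*pi} \<subseteq> ball 0 1"
    using assms by (auto simp: norm_mult)
  then have "continuous_on {0..2*pi} (\<lambda>t. f (of_real r * cis t))"
    by (intro continuous_on_compose2[OF holomorphic_on_imp_continuous_on[OF assms(1)]]
        continuous_intros) auto
  then show "continuous_on {0..2*pi} (\<lambda>t. (cmod (f (of_real r * cis t)))\<^sup>2)"
    by (intro continuous_intros)
qed

lemma circle_mean_nonneg: "0 \<le> circle_mean f r"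
  by (cases "(\<lambda>t. (cmod (f (of_real r * cis t)))\<^sup>2) integrable_on {0..2*pi}")
    (auto simp: circle_mean_def not_integrable_integral intro!: divide_nonneg_pos integral_nonneg)

lemma circle_mean_cmult: "circle_mean (\<lambda>z. c * f z) r = (cmod c)\<^sup>2 * circle_mean f r"
  by (simp add: circle_mean_def norm_mult power_mult_distrib)

lemma circle_mean_le_mult:
  assumes "f holomorphic_on ball 0 1" "h holomorphic_on ball 0 1" "0 \<le> r" "r < 1"
    and "\<And>z. z \<in> ball 0 1 \<Longrightarrow> cmod (f z) \<le> C * cmod (h z)"
  shows "circle_mean f r \<le> C\<^sup>2 * circle_mean h r"
proof -
  have "integral {0..2*pi} (\<lambda>t. (cmod (f (of_real r * cis t)))\<^sup>2)
      \<le> integral {0..2*pi} (\<lambda>t. C\<^sup>2 * (cmod (h (of_real r * cis t)))\<^sup>2)"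
  proof (rule integral_le)
    fix t
    have "cmod (f (of_real r * cis t)) \<le> C * cmod (h (of_real r * cis t))"
      using assms by (intro assms(5)) (auto simp: norm_mult)
    from power_mono[OF this, of 2]
    show "(cmod (f (of_real r * cis t)))\<^sup>2 \<le> C\<^sup>2 * (cmod (h (of_real r * cis t)))\<^sup>2"
      by (simp add: power_mult_distrib)
  qed (use assms in \<open>auto intro!: circle_integrable integrable_on_mult_right\<close>)
  then show ?thesis
    by (simp add: circle_mean_def divide_right_mono)
qed

lemma circle_mean_add_le:
  assumes "f holomorphic_on ball 0 1" "g holomorphic_on ball 0 1" "0 \<le> r" "r < 1" "0 < e"
  shows "circle_mean (\<lambda>z. f z + g z) r \<le> (1 + e) * circle_mean f r + (1 + 1/e) * circle_mean g r"
proof -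
  have *: "(cmod (a + b))\<^sup>2 \<le> (1 + e) * (cmod a)\<^sup>2 + (1 + 1/e) * (cmod b)\<^sup>2" for a b
  proof -
    have "0 \<le> (e * cmod a - cmod b)\<^sup>2 / e"
      using assms by simp
    then have "2 * cmod a * cmod b \<le> e * (cmod a)\<^sup>2 + (cmod b)\<^sup>2 / e"
      using assms by (simp add: field_simps power2_eq_square)
    moreover have "(cmod (a + b))\<^sup>2 \<le> (cmod a + cmod b)\<^sup>2"
      by (intro power_mono norm_triangle_ineq) auto
    ultimately show ?thesis
      by (simp add: power2_sum algebra_simps)
  qed
  let ?I = "\<lambda>f. integral {0..2*pi} (\<lambda>t. (cmod (f (of_real r * cis t)))\<^sup>2)"
  have "?I (\<lambda>z. f z + g z)
      \<le> integral {0..2*pi} (\<lambda>t. (1 + e) * (cmod (f (of_real r * cis t)))\<^sup>2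
            + (1 + 1/e) * (cmod (g (of_real r * cis t)))\<^sup>2)"
    using assms by (intro integral_le * integrable_add integrable_on_mult_right circle_integrable
        holomorphic_intros)
  also have "\<dots> = (1 + e) * ?I f + (1 + 1/e) * ?I g"
    using assms circle_integrable[of f r] circle_integrable[of g r]
    by (subst integral_add) (auto intro!: integrable_on_mult_right)
  finally show ?thesis
    by (simp add: circle_mean_def divide_simps)
qed

lemma hardy_norm_power2:
  assumes "bdd_above (circle_mean f ` {0..<1})"
  shows "(hardy_norm f)\<^sup>2 = (SUP r\<in>{0..<1}. circle_mean f r)"
proof -
  have "circle_mean f 0 \<le> (SUP r\<in>{0..<1}. circle_mean f r)"
    using assms by (intro cSUP_upper) auto
  then show ?thesis
    using circle_mean_nonneg[of f 0] by (simp add: hardy_norm_def)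
qed

lemma circle_mean_le_hardy_norm:
  assumes "bdd_above (circle_mean f ` {0..<1})" "0 \<le> r" "r < 1"
  shows "circle_mean f r \<le> (hardy_norm f)\<^sup>2"
  unfolding hardy_norm_power2[OF assms(1)] using assms by (intro cSUP_upper) auto

lemma hardy_norm_nonneg:
  assumes "bdd_above (circle_mean f ` {0..<1})"
  shows "0 \<le> hardy_norm f"
proof -
  have "circle_mean f 0 \<le> (SUP r\<in>{0..<1}. circle_mean f r)"
    using assms by (intro cSUP_upper) auto
  then show ?thesis
    using circle_mean_nonneg[of f 0] by (simp add: hardy_norm_def)
qed

lemma hardy_norm_le:
  assumes "0 \<le> C" "\<And>r. 0 \<le> r \<Longrightarrow> r < 1 \<Longrightarrow> circle_mean f r \<le> C\<^sup>2"
  shows "hardy_norm f \<le> C"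
proof -
  have "(SUP r\<in>{0..<1}. circle_mean f r) \<le> C\<^sup>2"
    using assms by (intro cSUP_least) auto
  then show ?thesis
    using assms by (simp add: hardy_norm_def real_le_lsqrt)
qed

lemma hardy_norm_eq_0:
  assumes "f holomorphic_on ball 0 1" "bdd_above (circle_mean f ` {0..<1})" "hardy_norm f = 0"
    and "z \<in> ball 0 1"
  shows "f z = 0"
proof -
  define r where "r = cmod z"
  have r: "0 \<le> r" "r < 1"
    using assms by (auto simp: r_def)
  have "circle_mean f r = 0"
    using circle_mean_le_hardy_norm[OF assms(2) r] circle_mean_nonneg[of f r] assms(3) by simp
  then have I: "integral {0..2*pi} (\<lambda>t. (cmod (f (of_real r * cis t)))\<^sup>2) = 0"
    by (simp add: circle_mean_def)
  have "(\<lambda>t. of_real r * cis t) ` {0..2*pi} \<subseteq> ball 0 1"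
    using r by (auto simp: norm_mult)
  then have "continuous_on {0..2*pi} (\<lambda>t. f (of_real r * cis t))"
    by (intro continuous_on_compose2[OF holomorphic_on_imp_continuous_on[OF assms(1)]]
        continuous_intros) auto
  then have "continuous_on {0..2*pi} (\<lambda>t. (cmod (f (of_real r * cis t)))\<^sup>2)"
    by (intro continuous_intros)
  then have *: "(cmod (f (of_real r * cis t)))\<^sup>2 = 0" if "t \<in> {0..2*pi}" for t
    using integral_eq_0_iff[of 0 "2*pi" "\<lambda>t. (cmod (f (of_real r * cis t)))\<^sup>2"] I that by auto
  have "z = of_real r * cis (Arg2pi z)"
    using Arg2pi_eq[of z] by (simp add: r_def cis_conv_exp mult.commute)
  moreover have "Arg2pi z \<in> {0..2*pi}"
    using Arg2pi_ge_0[of z] Arg2pi_lt_2pi[of z] by auto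
  ultimately show ?thesis
    using * by (metis norm_eq_zero power_eq_0_iff)
qed

lemma circle_mean_add_le_hardy_norm:
  assumes "f holomorphic_on ball 0 1" "g holomorphic_on ball 0 1"
    and "bdd_above (circle_mean f ` {0..<1})" "bdd_above (circle_mean g ` {0..<1})"
    and "0 \<le> r" "r < 1"
  shows "circle_mean (\<lambda>z. f z + g z) r \<le> (hardy_norm f + hardy_norm g)\<^sup>2"
proof -
  let ?a = "hardy_norm f" and ?b = "hardy_norm g"
  have nn: "0 \<le> ?a" "0 \<le> ?b"
    using assms by (auto intro: hardy_norm_nonneg)
  have *: "circle_mean (\<lambda>z. f z + g z) r \<le> (?a + ?b + 2 * d)\<^sup>2" if "0 < d" for d
  proof -
    define a b where "a = ?a + d" and "b = ?b + d"
    have pos: "0 < a" "0 < b"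
      using nn that by (auto simp: a_def b_def)
    have "?a\<^sup>2 \<le> a\<^sup>2" "?b\<^sup>2 \<le> b\<^sup>2"
      using nn that by (auto simp: a_def b_def intro!: power_mono)
    then have le: "circle_mean f r \<le> a\<^sup>2" "circle_mean g r \<le> b\<^sup>2"
      using circle_mean_le_hardy_norm[OF assms(3,5,6)] circle_mean_le_hardy_norm[OF assms(4,5,6)]
      by auto
    have "circle_mean (\<lambda>z. f z + g z) r
        \<le> (1 + b/a) * circle_mean f r + (1 + 1/(b/a)) * circle_mean g r"
      using assms pos by (intro circle_mean_add_le) auto
    also have "\<dots> \<le> (1 + b/a) * a\<^sup>2 + (1 + 1/(b/a)) * b\<^sup>2"
      using pos le by (intro add_mono mult_left_mono) auto
    also have "\<dots> = (a + b)\<^sup>2"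
      using pos by (simp add: field_simps power2_eq_square)
    finally show ?thesis
      by (simp add: a_def b_def algebra_simps)
  qed
  have "((\<lambda>d. (?a + ?b + 2 * d)\<^sup>2) \<longlongrightarrow> (?a + ?b + 2 * 0)\<^sup>2) (at_right 0)"
    by (intro tendsto_intros)
  moreover have "\<forall>\<^sub>F d in at_right (0::real). circle_mean (\<lambda>z. f z + g z) r \<le> (?a + ?b + 2 * d)\<^sup>2"
    using eventually_at_right_less[of "0::real"] by eventually_elim (use * in auto)
  ultimately show ?thesis
    by (intro tendsto_lowerbound[of _ "(?a + ?b)\<^sup>2" "at_right 0"]) auto
qed

instantiation hardy2 :: complex_normed_vector
begin

lift_definition zero_hardy2 :: hardy2 is "\<lambda>_. 0"
  by (auto simp: circle_mean_def)

lift_definition plus_hardy2 :: "hardy2 \<Rightarrow> hardy2 \<Rightarrow> hardy2" is "\<lambda>f g z. f z + g z"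
proof -
  fix f g :: "complex \<Rightarrow> complex"
  assume f: "f holomorphic_on ball 0 1 \<and> (\<forall>z. z \<notin> ball 0 1 \<longrightarrow> f z = 0) \<and>
    bdd_above (circle_mean f ` {0..<1})"
  assume g: "g holomorphic_on ball 0 1 \<and> (\<forall>z. z \<notin> ball 0 1 \<longrightarrow> g z = 0) \<and>
    bdd_above (circle_mean g ` {0..<1})"
  have "bdd_above (circle_mean (\<lambda>z. f z + g z) ` {0..<1})"
    using f g circle_mean_add_le_hardy_norm[of f g]
    by (intro bdd_aboveI2[of _ _ "(hardy_norm f + hardy_norm g)\<^sup>2"]) simp
  with f g show "(\<lambda>z. f z + g z) holomorphic_on ball 0 1 \<and>
    (\<forall>z. z \<notin> ball 0 1 \<longrightarrow> f z + g z = 0) \<and> bdd_above (circle_mean (\<lambda>z. f z + g z) ` {0..<1})"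
    by (auto intro!: holomorphic_intros)
qed

lift_definition scaleC_hardy2 :: "complex \<Rightarrow> hardy2 \<Rightarrow> hardy2" is "\<lambda>c f z. c * f z"
proof -
  fix c and f :: "complex \<Rightarrow> complex"
  assume f: "f holomorphic_on ball 0 1 \<and> (\<forall>z. z \<notin> ball 0 1 \<longrightarrow> f z = 0) \<and>
    bdd_above (circle_mean f ` {0..<1})"
  have "bdd_above (circle_mean (\<lambda>z. c * f z) ` {0..<1})"
    using f circle_mean_le_hardy_norm[of f]
    by (intro bdd_aboveI2[of _ _ "(cmod c)\<^sup>2 * (hardy_norm f)\<^sup>2"])
      (auto simp: circle_mean_cmult intro!: mult_left_mono)
  with f show "(\<lambda>z. c * f z) holomorphic_on ball 0 1 \<and> (\<forall>z. z \<notin> ball 0 1 \<longrightarrow> c * f z = 0) \<and>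
    bdd_above (circle_mean (\<lambda>z. c * f z) ` {0..<1})"
    by (auto intro!: holomorphic_intros)
qed

definition uminus_hardy2 :: "hardy2 \<Rightarrow> hardy2"
  where "uminus_hardy2 f = (- 1) *\<^sub>C f"

definition minus_hardy2 :: "hardy2 \<Rightarrow> hardy2 \<Rightarrow> hardy2"
  where "minus_hardy2 f g = f + - g"

definition scaleR_hardy2 :: "real \<Rightarrow> hardy2 \<Rightarrow> hardy2"
  where "scaleR_hardy2 r f = complex_of_real r *\<^sub>C f"

lift_definition norm_hardy2 :: "hardy2 \<Rightarrow> real" is hardy_norm .

definition dist_hardy2 :: "hardy2 \<Rightarrow> hardy2 \<Rightarrow> real"
  where "dist_hardy2 f g = norm (f - g)"

definition sgn_hardy2 :: "hardy2 \<Rightarrow> hardy2"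
  where "sgn_hardy2 f = inverse (norm f) *\<^sub>R f"

definition uniformity_hardy2 :: "(hardy2 \<times> hardy2) filter"
  where "uniformity_hardy2 = (INF e\<in>{0<..}. principal {(f, g). dist f g < e})"

definition open_hardy2 :: "hardy2 set \<Rightarrow> bool"
  where "open_hardy2 S \<longleftrightarrow> (\<forall>f\<in>S. \<forall>\<^sub>F (f', g) in uniformity. f' = f \<longrightarrow> g \<in> S)"

instance
proof
  fix f g h :: hardy2 and a b :: real and c d :: complex and S :: "hardy2 set"
  show "f + g + h = f + (g + h)" by transfer (auto simp: algebra_simps)
  show "f + g = g + f" by transfer (auto simp: algebra_simps)
  show "0 + f = f" by transfer auto
  show "- f + f = 0" unfolding uminus_hardy2_def by transfer auto
  show "f - g = f + - g" by (rule minus_hardy2_def)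
  show Cadd: "c *\<^sub>C (f + g) = c *\<^sub>C f + c *\<^sub>C g" for c and f g :: hardy2
    by transfer (auto simp: algebra_simps)
  show Cadd2: "(c + d) *\<^sub>C f = c *\<^sub>C f + d *\<^sub>C f" for c d and f :: hardy2
    by transfer (auto simp: algebra_simps)
  show CC: "c *\<^sub>C d *\<^sub>C f = (c * d) *\<^sub>C f" for c d and f :: hardy2
    by transfer (auto simp: algebra_simps)
  show "complex_of_real a *\<^sub>C f = a *\<^sub>R f" by (simp add: scaleR_hardy2_def)
  show "a *\<^sub>R (f + g) = a *\<^sub>R f + a *\<^sub>R g" by (simp add: scaleR_hardy2_def Cadd)
  show "(a + b) *\<^sub>R f = a *\<^sub>R f + b *\<^sub>R f" by (simp add: scaleR_hardy2_def Cadd2)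
  show "a *\<^sub>R b *\<^sub>R f = (a * b) *\<^sub>R f" by (simp add: scaleR_hardy2_def CC)
  show "1 *\<^sub>R f = f" unfolding scaleR_hardy2_def by transfer auto
  show "dist f g = norm (f - g)" by (rule dist_hardy2_def)
  show "sgn f = inverse (norm f) *\<^sub>R f" by (rule sgn_hardy2_def)
  show "uniformity = (INF e\<in>{0<..}. principal {(f, g::hardy2). dist f g < e})"
    by (rule uniformity_hardy2_def)
  show "open S \<longleftrightarrow> (\<forall>f\<in>S. \<forall>\<^sub>F (f', g) in uniformity. f' = f \<longrightarrow> g \<in> S)"
    by (rule open_hardy2_def)
  show "norm f = 0 \<longleftrightarrow> f = 0"
  proof
    show "f = 0" if "norm f = 0"
    proof (rule fun_of_hardy2_inject[THEN iffD1], rule ext)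
      fix z
      have "hardy_norm (fun_of_hardy2 f) = 0"
        using that by (simp add: norm_hardy2.rep_eq)
      then show "fun_of_hardy2 f z = fun_of_hardy2 0 z"
        using hardy_norm_eq_0[of "fun_of_hardy2 f" z] fun_of_hardy2[of f]
        by (cases "z \<in> ball 0 1") (simp_all add: zero_hardy2.rep_eq)
    qed
    show "norm f = 0" if "f = 0"
      unfolding that by transfer (simp add: hardy_norm_def circle_mean_def)
  qed
  show "norm (f + g) \<le> norm f + norm g"
    by transfer (auto intro!: hardy_norm_le circle_mean_add_le_hardy_norm add_nonneg_nonneg
        hardy_norm_nonneg)
  have nn: "0 \<le> norm f" for f :: hardy2
    using fun_of_hardy2[of f] by (auto simp: norm_hardy2.rep_eq intro: hardy_norm_nonneg)
  have le: "norm (c *\<^sub>C f) \<le> cmod c * norm f" for c and f :: hardy2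
    unfolding norm_hardy2.rep_eq[of "c *\<^sub>C f"] scaleC_hardy2.rep_eq
  proof (rule hardy_norm_le)
    show "0 \<le> cmod c * norm f"
      by (intro mult_nonneg_nonneg nn norm_ge_zero)
    fix r :: real
    assume "0 \<le> r" "r < 1"
    then have "circle_mean (fun_of_hardy2 f) r \<le> (norm f)\<^sup>2"
      using circle_mean_le_hardy_norm[of "fun_of_hardy2 f" r] fun_of_hardy2[of f]
      by (simp add: norm_hardy2.rep_eq)
    then show "circle_mean (\<lambda>z. c * fun_of_hardy2 f z) r \<le> (cmod c * norm f)\<^sup>2"
      by (simp add: circle_mean_cmult power_mult_distrib mult_left_mono)
  qed
  show normC: "norm (c *\<^sub>C f) = cmod c * norm f" for c and f :: hardy2
  proof (rule antisym[OF le])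
    show "cmod c * norm f \<le> norm (c *\<^sub>C f)"
    proof (cases "c = 0")
      case True
      with nn[of "c *\<^sub>C f"] show ?thesis by simp
    next
      case False
      have "inverse c *\<^sub>C c *\<^sub>C f = f"
        unfolding CC using False by transfer auto
      then have "norm f \<le> cmod (inverse c) * norm (c *\<^sub>C f)"
        using le[of "inverse c" "c *\<^sub>C f"] by simp
      then have "cmod c * norm f \<le> cmod c * (inverse (cmod c) * norm (c *\<^sub>C f))"
        by (intro mult_left_mono) (auto simp: norm_inverse)
      then show ?thesis
        using False by (simp flip: mult.assoc)
    qed
  qed
  show "norm (a *\<^sub>R f) = \<bar>a\<bar> * norm f"
    by (simp add: scaleR_hardy2_def normC)
qed

end


section \<open>Analytic Toeplitz operators\<close>

text \<open>
  Meaningful for bounded analytic symbols only: then \<open>\<phi> h\<close> lies in the Hardy space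
  (\<open>fun_of_hardy2_toeplitz\<close>) and the operator is bounded (\<open>bounded_clinear_toeplitz\<close>).
\<close>

definition toeplitz :: "(complex \<Rightarrow> complex) \<Rightarrow> hardy2 \<Rightarrow> hardy2"
  where "toeplitz \<phi> h = Abs_hardy2 (\<lambda>z. \<phi> z * fun_of_hardy2 h z)"

context
  fixes \<phi> :: "complex \<Rightarrow> complex"
  assumes hol: "\<phi> holomorphic_on ball 0 1" and bdd: "bounded (\<phi> ` ball 0 1)"
begin

lemma circle_mean_toeplitz_le:
  "\<exists>C\<ge>0. \<forall>h. \<forall>r\<in>{0..<1}. circle_mean (\<lambda>z. \<phi> z * fun_of_hardy2 h z) r \<le> (norm h * C)\<^sup>2"
proof -
  obtain C where C: "\<And>z. z \<in> ball 0 1 \<Longrightarrow> cmod (\<phi> z) \<le> C"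
    using bdd unfolding bounded_iff by blast
  have "0 \<le> C"
    using C[of 0] norm_ge_zero[of "\<phi> 0"] by (simp del: norm_ge_zero)
  moreover have "circle_mean (\<lambda>z. \<phi> z * fun_of_hardy2 h z) r \<le> (norm h * C)\<^sup>2"
    if r: "r \<in> {0..<1}" for h r
  proof -
    have h: "fun_of_hardy2 h holomorphic_on ball 0 1"
        "bdd_above (circle_mean (fun_of_hardy2 h) ` {0..<1})"
      using fun_of_hardy2[of h] by auto
    have "circle_mean (\<lambda>z. \<phi> z * fun_of_hardy2 h z) r \<le> C\<^sup>2 * circle_mean (fun_of_hardy2 h) r"
      using r h hol C
      by (intro circle_mean_le_mult) (auto intro!: holomorphic_intros mult_right_mono simp: norm_mult)
    also have "\<dots> \<le> C\<^sup>2 * (norm h)\<^sup>2"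
      using circle_mean_le_hardy_norm[OF h(2), of r] r
      by (intro mult_left_mono) (auto simp: norm_hardy2.rep_eq)
    finally show ?thesis
      by (simp add: power_mult_distrib mult.commute)
  qed
  ultimately show ?thesis
    by blast
qed

lemma fun_of_hardy2_toeplitz: "fun_of_hardy2 (toeplitz \<phi> h) = (\<lambda>z. \<phi> z * fun_of_hardy2 h z)"
proof -
  obtain C where C: "\<forall>h. \<forall>r\<in>{0..<1}.
      circle_mean (\<lambda>z. \<phi> z * fun_of_hardy2 h z) r \<le> (norm h * C)\<^sup>2"
    using circle_mean_toeplitz_le by blast
  have "bdd_above (circle_mean (\<lambda>z. \<phi> z * fun_of_hardy2 h z) ` {0..<1})"
    by (intro bdd_aboveI2[of _ _ "(norm h * C)\<^sup>2"]) (simp add: C)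
  then show ?thesis
    unfolding toeplitz_def using fun_of_hardy2[of h] hol
    by (intro Abs_hardy2_inverse) (auto intro!: holomorphic_intros)
qed

lemma bounded_clinear_toeplitz: "bounded_clinear (toeplitz \<phi>)"
  unfolding bounded_clinear_def
proof (intro conjI allI)
  obtain C where C: "0 \<le> C" "\<forall>h. \<forall>r\<in>{0..<1}.
      circle_mean (\<lambda>z. \<phi> z * fun_of_hardy2 h z) r \<le> (norm h * C)\<^sup>2"
    using circle_mean_toeplitz_le by blast
  show C': "toeplitz \<phi> (c *\<^sub>C f) = c *\<^sub>C toeplitz \<phi> f" for c f
    by (rule fun_of_hardy2_inject[THEN iffD1])
      (auto simp: fun_of_hardy2_toeplitz scaleC_hardy2.rep_eq)
  show "bounded_linear (toeplitz \<phi>)"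
  proof (rule bounded_linear_intro[of _ C])
    fix f g :: hardy2 and a :: real
    show "toeplitz \<phi> (f + g) = toeplitz \<phi> f + toeplitz \<phi> g"
      by (rule fun_of_hardy2_inject[THEN iffD1])
        (auto simp: fun_of_hardy2_toeplitz plus_hardy2.rep_eq algebra_simps)
    show "toeplitz \<phi> (a *\<^sub>R f) = a *\<^sub>R toeplitz \<phi> f"
      by (simp add: scaleR_hardy2_def C')
    show "norm (toeplitz \<phi> f) \<le> norm f * C"
      unfolding norm_hardy2.rep_eq[of "toeplitz \<phi> f"] fun_of_hardy2_toeplitz
      using C by (intro hardy_norm_le) auto
  qed
qed

end

end

theory Submission
  imports Defs
begin

text \<open>
  Since \<open>\<phi>\<close> is a covering map and the disc is simply connected, \<open>\<psi>\<close> lifts through \<open>\<phi>\<close>: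
  there is a holomorphic self-map \<open>w\<close> of the disc with \<open>\<psi> = \<phi> \<circ> w\<close>
  (\<open>covering_space_lift_holomorphic\<close>). The composition operator \<open>X h = h \<circ> w\<close> then satisfies
  \<open>X (\<phi> h) = (\<phi> \<circ> w) (h \<circ> w) = \<psi> X h\<close>, and it fixes the constant \<open>1\<close>, so it is not zero.

  What remains is that \<open>X\<close> is bounded on the Hardy space, for an arbitrary value of \<open>w 0\<close>. This is
  Littlewood's subordination principle (\<open>circle_mean_subordination\<close>). If \<open>w\<close> maps the closed
  disc of radius \<open>r\<close> into the open disc of radius \<open>R\<close>, then \<open>\<bar>h\<bar>\<^sup>2\<close> is dominated on that disc by the Poisson
  integral of its values on the circle of radius \<open>R\<close>. That Poisson integral \<open>P\<close> is harmonic, hence so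
  is \<open>P \<circ> w\<close>, whose mean over the circle of radius \<open>r\<close> is therefore \<open>P (w 0)\<close>; and Harnack's estimate of the Poisson kernel bounds this value by a multiple of the
  circular mean of \<open>\<bar>h\<bar>\<^sup>2\<close>. The multiple stays bounded as \<open>R\<close> tends to \<open>1\<close>.
\<close>

section \<open>The Poisson kernel\<close>

definition poisson_kernel :: "complex \<Rightarrow> complex \<Rightarrow> real"
  where "poisson_kernel \<zeta> w = ((cmod \<zeta>)\<^sup>2 - (cmod w)\<^sup>2) / (cmod (\<zeta> - w))\<^sup>2"

text \<open>This formula exhibits the kernel as a harmonic function of \<open>w\<close>.\<close>

lemma poisson_kernel_eq_Re: "poisson_kernel \<zeta> w = Re ((\<zeta> + w) / (\<zeta> - w))"
  by (simp add: poisson_kernel_def Re_divide cmod_power2) (simp add: power2_eq_square algebra_simps)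

lemma poisson_kernel_nonneg: "cmod w \<le> cmod \<zeta> \<Longrightarrow> 0 \<le> poisson_kernel \<zeta> w"
  by (simp add: poisson_kernel_def power_mono)

lemma poisson_kernel_le:
  assumes "cmod w < cmod \<zeta>"
  shows "poisson_kernel \<zeta> w \<le> (cmod \<zeta> + cmod w) / (cmod \<zeta> - cmod w)"
proof -
  let ?a = "cmod \<zeta>" and ?b = "cmod w"
  have "(?a - ?b)\<^sup>2 \<le> (cmod (\<zeta> - w))\<^sup>2"
    using assms norm_triangle_ineq2[of \<zeta> w] by (intro power_mono) auto
  then have "poisson_kernel \<zeta> w \<le> (?a\<^sup>2 - ?b\<^sup>2) / (?a - ?b)\<^sup>2"
    unfolding poisson_kernel_def using assms
    by (intro divide_left_mono) (auto simp: power_mono intro!: mult_pos_pos)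
  also have "\<dots> = (?a + ?b) / (?a - ?b)"
    using assms by (simp add: power2_eq_square divide_simps) (simp add: algebra_simps)
  finally show ?thesis .
qed

text \<open>
  The Poisson formula is Cauchy's formula at \<open>z\<close> for \<open>g\<close> times the function
  \<open>(R\<^sup>2 - \<bar>z\<bar>\<^sup>2) / (R\<^sup>2 - cnj z u)\<close> of \<open>u\<close>, which is \<open>1\<close> at \<open>z\<close>: on the circle \<open>R\<^sup>2 = u cnj u\<close>, so
  that the denominator is \<open>u cnj (u - z)\<close>, and the integrand becomes \<open>g\<close> times the Poisson kernel.
\<close>

lemma Poisson_formula:
  assumes g: "g holomorphic_on cball 0 R" and z: "cmod z < R"
  shows "((\<lambda>t. of_real (poisson_kernel (of_real R * cis t) z) * g (of_real R * cis t))
           has_integral 2 * of_real pi * g z) {0..2*pi}"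
proof -
  have R: "0 < R"
    using z norm_ge_zero[of z] by linarith
  define G where "G = (\<lambda>u. g u * (of_real (R\<^sup>2 - (cmod z)\<^sup>2) / (of_real (R\<^sup>2) - cnj z * u)))"
  have nz: "of_real (R\<^sup>2) - cnj z * u \<noteq> 0" if "u \<in> cball 0 R" for u
  proof
    assume "of_real (R\<^sup>2) - cnj z * u = 0"
    then have "R\<^sup>2 = cmod z * cmod u"
      by (metis complex_mod_cnj eq_iff_diff_eq_0 norm_mult norm_of_real abs_power2)
    also have "\<dots> \<le> cmod z * R"
      using that by (intro mult_left_mono) auto
    also have "\<dots> < R * R"
      using z R by simp
    finally show False
      by (simp add: power2_eq_square)
  qed
  have "(cmod z)\<^sup>2 < R\<^sup>2"
    using z by (intro power_strict_mono) auto
  then have Gz: "G z = g z"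
    using nz[of z] z
    by (simp add: G_def complex_norm_square mult.commute flip: of_real_power)
  have "G holomorphic_on cball 0 R"
    unfolding G_def using nz by (intro holomorphic_intros g) auto
  from Cauchy_integral_circlepath_simple[OF this, of z]
  have "((\<lambda>u. G u / (u - z)) has_contour_integral 2 * of_real pi * \<i> * g z)
          (part_circlepath 0 R 0 (2*pi))"
    using z by (simp add: circlepath_def Gz)
  then have "((\<lambda>t. G (of_real R * cis t) / (of_real R * cis t - z) * of_real R * \<i> * cis t)
          has_integral 2 * of_real pi * \<i> * g z) {0..2*pi}"
    by (subst (asm) has_contour_integral_part_circlepath_iff) auto
  from has_integral_mult_right[OF this, of "- \<i>"]
  have I: "((\<lambda>t. - \<i> * (G (of_real R * cis t) / (of_real R * cis t - z) * of_real R * \<i> * cis t))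
          has_integral 2 * of_real pi * g z) {0..2*pi}"
    by (simp add: algebra_simps)
  show ?thesis
  proof (rule has_integral_eq[OF _ I])
    fix t :: real
    define u where "u = of_real R * cis t"
    have u: "cmod u = R"
      using R by (simp add: u_def norm_mult)
    then have "u \<noteq> 0" "u - z \<noteq> 0"
      using R z by auto
    have "of_real (R\<^sup>2) - cnj z * u = u * cnj (u - z)"
      using complex_norm_square[of u] u by (simp add: algebra_simps)
    then have "- \<i> * (G u / (u - z) * of_real R * \<i> * cis t)
        = g u * (of_real (R\<^sup>2 - (cmod z)\<^sup>2) / (u * cnj (u - z))) / (u - z) * u"
      by (simp add: G_def u_def mult_ac)
    also have "\<dots> = g u * (of_real (R\<^sup>2 - (cmod z)\<^sup>2) / ((u - z) * cnj (u - z)))"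
      using \<open>u \<noteq> 0\<close> by simp
    also have "\<dots> = of_real (poisson_kernel u z) * g u"
      by (simp only: complex_norm_square[symmetric] poisson_kernel_def u of_real_divide
          of_real_power mult.commute)
    finally show "- \<i> * (G (of_real R * cis t) / (of_real R * cis t - z) * of_real R * \<i> * cis t)
        = of_real (poisson_kernel (of_real R * cis t) z) * g (of_real R * cis t)"
      by (simp add: u_def)
  qed
qed

text \<open>This is the Poisson formula at \<open>z = 0\<close>, where the kernel is \<open>1\<close>.\<close>

lemma holomorphic_mean_value:
  assumes "g holomorphic_on cball 0 r" "0 \<le> r"
  shows "((\<lambda>t. g (of_real r * cis t)) has_integral 2 * of_real pi * g 0) {0..2*pi}"
proof (cases "r = 0")
  case True
  then show ?thesis
    using has_integral_const_real[of "g 0" 0 "2*pi"] by (simp add: scaleR_conv_of_real)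
next
  case False
  then show ?thesis
    using Poisson_formula[of g r 0] assms by (simp add: poisson_kernel_def norm_mult)
qed

section \<open>Littlewood's subordination principle\<close>

lemma circle_continuous:
  assumes "f holomorphic_on cball 0 r" "0 \<le> r"
  shows "continuous_on A (\<lambda>t. f (of_real r * cis t))"
proof -
  have "(\<lambda>t. of_real r * cis t) ` A \<subseteq> cball 0 r"
    using assms by (auto simp: norm_mult)
  then show ?thesis
    by (intro continuous_on_compose2[OF holomorphic_on_imp_continuous_on[OF assms(1)]]
        continuous_intros) auto
qed

text \<open>
  The Poisson formula is applied to \<open>h\<^sup>2\<close>, which is again holomorphic; so the subharmonicity of
  \<open>\<bar>h\<bar>\<^sup>2\<close> is just the triangle inequality for integrals.
\<close>

lemma cmod_power2_le_Poisson_integral: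
  assumes h: "h holomorphic_on cball 0 R" and z: "cmod z < R"
  shows "(\<lambda>t. poisson_kernel (of_real R * cis t) z * (cmod (h (of_real R * cis t)))\<^sup>2)
           integrable_on {0..2*pi}" (is "?K integrable_on _")
    and "2 * pi * (cmod (h z))\<^sup>2
           \<le> integral {0..2*pi}
              (\<lambda>t. poisson_kernel (of_real R * cis t) z * (cmod (h (of_real R * cis t)))\<^sup>2)"
proof -
  have R: "0 < R"
    using z norm_ge_zero[of z] by linarith
  have nz: "of_real R * cis t - z \<noteq> 0" for t
    using z R by (auto simp: norm_mult)
  show int: "?K integrable_on {0..2*pi}"
    unfolding poisson_kernel_def using R nz
    by (intro integrable_continuous_real continuous_intros circle_continuous h) auto
  have "(\<lambda>u. (h u)\<^sup>2) holomorphic_on cball 0 R"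
    by (intro holomorphic_intros h)
  from Poisson_formula[OF this z]
  have P: "((\<lambda>t. of_real (poisson_kernel (of_real R * cis t) z) * (h (of_real R * cis t))\<^sup>2)
      has_integral 2 * of_real pi * (h z)\<^sup>2) {0..2*pi}" .
  have "norm (integral {0..2*pi}
        (\<lambda>t. of_real (poisson_kernel (of_real R * cis t) z) * (h (of_real R * cis t))\<^sup>2))
      \<le> integral {0..2*pi} ?K"
  proof (rule integral_norm_bound_integral[OF _ int])
    fix t
    have "0 \<le> poisson_kernel (of_real R * cis t) z"
      using z R by (intro poisson_kernel_nonneg) (simp add: norm_mult)
    then show "norm (of_real (poisson_kernel (of_real R * cis t) z) * (h (of_real R * cis t))\<^sup>2)
        \<le> ?K t"
      by (simp add: norm_mult norm_power)
  qed (use P in blast)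
  then show "2 * pi * (cmod (h z))\<^sup>2 \<le> integral {0..2*pi} ?K"
    using integral_unique[OF P] by (simp add: norm_mult norm_power)
qed

text \<open>
  The Poisson kernel is harmonic in its second argument, so the mean of its composition with
  \<open>w\<close> is its value at \<open>w 0\<close>.
\<close>

lemma poisson_kernel_mean:
  assumes w: "w holomorphic_on cball 0 r" and r: "0 \<le> r"
    and less: "\<And>z. z \<in> cball 0 r \<Longrightarrow> cmod (w z) < cmod \<zeta>"
  shows "integral {0..2*pi} (\<lambda>s. poisson_kernel \<zeta> (w (of_real r * cis s)))
           = 2 * pi * poisson_kernel \<zeta> (w 0)"
proof -
  have "(\<lambda>z. (\<zeta> + w z) / (\<zeta> - w z)) holomorphic_on cball 0 r"
    using less by (intro holomorphic_intros w) fastforce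
  from has_integral_linear[OF holomorphic_mean_value[OF this r] bounded_linear_Re]
  have "((\<lambda>s. poisson_kernel \<zeta> (w (of_real r * cis s)))
      has_integral Re (of_real (2 * pi) * ((\<zeta> + w 0) / (\<zeta> - w 0)))) {0..2*pi}"
    by (simp add: o_def poisson_kernel_eq_Re)
  then show ?thesis
    by (simp only: times_complex.sel(1) Re_complex_of_real Im_complex_of_real mult_zero_left
        diff_zero poisson_kernel_eq_Re integral_unique)
qed

text \<open>
  The mean of \<open>\<bar>h \<circ> w\<bar>\<^sup>2\<close> is at most a double integral of the Poisson kernel against \<open>\<bar>h\<bar>\<^sup>2\<close>. Integrating
  in the other order reduces the kernel to its value at \<open>w 0\<close>, which Harnack's estimate bounds
  uniformly in the remaining variable.
\<close>

theorem circle_mean_subordination: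
  assumes w: "w holomorphic_on cball 0 r" and r: "0 \<le> r"
    and wR: "\<And>z. z \<in> cball 0 r \<Longrightarrow> cmod (w z) < R"
    and h: "h holomorphic_on cball 0 R"
  shows "circle_mean (\<lambda>z. h (w z)) r
           \<le> (R + cmod (w 0)) / (R - cmod (w 0)) * circle_mean h R"
proof -
  let ?I = "{0..2*pi}" and ?C = "(R + cmod (w 0)) / (R - cmod (w 0))"
  define q where "q t = (cmod (h (of_real R * cis t)))\<^sup>2" for t
  define k where "k s t = poisson_kernel (of_real R * cis t) (w (of_real r * cis s))" for s t
  have w0: "cmod (w 0) < R"
    using wR[of 0] r by simp
  then have R: "0 < R"
    using norm_ge_zero[of "w 0"] by linarith
  have ws: "cmod (w (of_real r * cis s)) < R" for s
    using r by (intro wR) (simp add: norm_mult)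
  have cont_w: "continuous_on A (\<lambda>s. w (of_real r * cis s))" for A
    using w r by (rule circle_continuous)
  have cont_q: "continuous_on A q" for A
    unfolding q_def using R by (intro continuous_intros circle_continuous h) auto
  have nz: "of_real R * cis t - w (of_real r * cis s) \<noteq> 0" for s t
  proof
    assume "of_real R * cis t - w (of_real r * cis s) = 0"
    then have "cmod (w (of_real r * cis s)) = cmod (of_real R * cis t)"
      by simp
    then show False
      using ws[of s] R by (simp add: norm_mult)
  qed
  have cont: "continuous_on (cbox (0, 0) (2*pi, 2*pi)) (\<lambda>(s, t). k s t * q t)"
    unfolding k_def poisson_kernel_def split_def using nz
    by (intro continuous_intros continuous_on_compose2[OF cont_w[of UNIV]]
        continuous_on_compose2[OF cont_q[of UNIV]]) auto
  have kq: "(\<lambda>t. k s t * q t) integrable_on ?I"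
       "2 * pi * (cmod (h (w (of_real r * cis s))))\<^sup>2 \<le> integral ?I (\<lambda>t. k s t * q t)" for s
    using cmod_power2_le_Poisson_integral[OF h ws[of s]] by (simp_all add: k_def q_def)
  have "2 * pi * integral ?I (\<lambda>s. (cmod (h (w (of_real r * cis s))))\<^sup>2)
      = integral ?I (\<lambda>s. 2 * pi * (cmod (h (w (of_real r * cis s))))\<^sup>2)"
    by simp
  also have "\<dots> \<le> integral ?I (\<lambda>s. integral ?I (\<lambda>t. k s t * q t))"
  proof (rule integral_le)
    have "continuous_on ?I (\<lambda>s. h (w (of_real r * cis s)))"
      using less_imp_le[OF ws]
      by (intro continuous_on_compose2[OF holomorphic_on_imp_continuous_on[OF h] cont_w]) auto
    then show "(\<lambda>s. 2 * pi * (cmod (h (w (of_real r * cis s))))\<^sup>2) integrable_on ?I"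
      by (intro integrable_continuous_real continuous_intros)
    show "(\<lambda>s. integral ?I (\<lambda>t. k s t * q t)) integrable_on ?I"
      using integral_continuous_on_param[of "{0..2*pi}" 0 "2*pi" "\<lambda>s t. k s t * q t"] cont
      by (intro integrable_continuous_real) (simp add: cbox_Pair_eq)
  qed (rule kq)
  also have "\<dots> = integral ?I (\<lambda>t. integral ?I (\<lambda>s. k s t * q t))"
    using integral_swap_continuous[OF cont] by simp
  also have "\<dots> = integral ?I (\<lambda>t. 2 * pi * poisson_kernel (of_real R * cis t) (w 0) * q t)"
    unfolding k_def using poisson_kernel_mean[OF w r, of "of_real R * cis _"] wR R
    by (simp add: norm_mult)
  also have "\<dots> \<le> integral ?I (\<lambda>t. 2 * pi * ?C * q t)"
  proof (rule integral_le)
    have "(\<lambda>t. 2 * pi * (poisson_kernel (of_real R * cis t) (w 0) * q t)) integrable_on ?I"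
      unfolding q_def
      by (intro integrable_on_mult_right cmod_power2_le_Poisson_integral(1) h w0)
    then show "(\<lambda>t. 2 * pi * poisson_kernel (of_real R * cis t) (w 0) * q t) integrable_on ?I"
      by (simp add: mult.assoc)
    show "(\<lambda>t. 2 * pi * ?C * q t) integrable_on ?I"
      by (intro integrable_continuous_real continuous_intros cont_q)
    fix t
    have "poisson_kernel (of_real R * cis t) (w 0) \<le> ?C"
      using poisson_kernel_le[of "w 0" "of_real R * cis t"] w0 R by (simp add: norm_mult)
    then show "2 * pi * poisson_kernel (of_real R * cis t) (w 0) * q t \<le> 2 * pi * ?C * q t"
      by (intro mult_right_mono mult_left_mono) (auto simp: q_def)
  qed
  also have "\<dots> = 2 * pi * (?C * integral ?I q)"
    by (simp add: mult.assoc)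
  finally have "integral ?I (\<lambda>s. (cmod (h (w (of_real r * cis s))))\<^sup>2) \<le> ?C * integral ?I q"
    by (rule mult_left_le_imp_le) simp
  then show ?thesis
    unfolding circle_mean_def q_def
    by (metis (no_types, lifting) divide_right_mono pi_ge_zero times_divide_eq_right
        mult_nonneg_nonneg zero_le_numeral)
qed

section \<open>Composition operators on the Hardy space\<close>

definition compose_hardy2 :: "(complex \<Rightarrow> complex) \<Rightarrow> hardy2 \<Rightarrow> hardy2"
  where "compose_hardy2 w h = Abs_hardy2 (\<lambda>z. if z \<in> ball 0 1 then fun_of_hardy2 h (w z) else 0)"

context
  fixes w :: "complex \<Rightarrow> complex"
  assumes w: "w holomorphic_on ball 0 1" and w_ball: "w \<in> ball 0 1 \<rightarrow> ball 0 1"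
begin

lemma norm_self_map_less_1: "z \<in> ball 0 1 \<Longrightarrow> cmod (w z) < 1"
  using w_ball by (auto simp: Pi_iff)

lemma circle_mean_compose_le:
  assumes r: "0 \<le> r" "r < 1"
  shows "circle_mean (\<lambda>z. if z \<in> ball 0 1 then fun_of_hardy2 h (w z) else 0) r
           \<le> (norm h * sqrt (4 / (1 - cmod (w 0))))\<^sup>2"
proof -
  have h: "fun_of_hardy2 h holomorphic_on ball 0 1"
      "bdd_above (circle_mean (fun_of_hardy2 h) ` {0..<1})"
    using fun_of_hardy2[of h] by auto
  have w0: "cmod (w 0) < 1"
    by (simp add: norm_self_map_less_1)
  have sub: "cball 0 r \<subseteq> (ball 0 1 :: complex set)"
    using r by auto
  then have wr: "w holomorphic_on cball 0 r"
    using w holomorphic_on_subset by blast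
  have "compact (w ` cball 0 r)" "w ` cball 0 r \<noteq> {}"
    using r by (auto intro!: compact_continuous_image holomorphic_on_imp_continuous_on wr)
  then obtain m where m: "m \<in> w ` cball 0 r" "\<And>u. u \<in> w ` cball 0 r \<Longrightarrow> cmod u \<le> cmod m"
    using continuous_attains_sup[of "w ` cball 0 r" cmod] continuous_on_norm_id by blast
  have "cmod m < 1"
    using m(1) sub norm_self_map_less_1 by auto
  \<comment> \<open>Besides exceeding \<open>\<bar>w\<bar>\<close> on the disc of radius \<open>r\<close>, the radius \<open>R\<close> must keep away from \<open>\<bar>w 0\<bar>\<close>,
    by an amount that does not depend on \<open>r\<close>.\<close>
  define R where "R = max ((1 + cmod m) / 2) ((1 + cmod (w 0)) / 2)"
  have R: "R < 1" "(1 + cmod (w 0)) / 2 \<le> R" "cmod m < R"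
    using \<open>cmod m < 1\<close> w0 by (auto simp: R_def max_def field_simps)
  have R0: "0 \<le> R"
    using R(3) norm_ge_zero[of m] by linarith
  have "circle_mean (\<lambda>z. if z \<in> ball 0 1 then fun_of_hardy2 h (w z) else 0) r
      = circle_mean (\<lambda>z. fun_of_hardy2 h (w z)) r"
    using r by (simp add: circle_mean_def norm_mult)
  also have "\<dots> \<le> (R + cmod (w 0)) / (R - cmod (w 0)) * circle_mean (fun_of_hardy2 h) R"
  proof (rule circle_mean_subordination[OF wr r(1)])
    show "cmod (w z) < R" if "z \<in> cball 0 r" for z
      using m(2)[of "w z"] that R(3) by auto
    show "fun_of_hardy2 h holomorphic_on cball 0 R"
      using R(1) by (intro holomorphic_on_subset[OF h(1)]) auto
  qed
  also have "\<dots> \<le> 4 / (1 - cmod (w 0)) * (norm h)\<^sup>2"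
  proof (intro mult_mono)
    have "(R + cmod (w 0)) / (R - cmod (w 0)) \<le> 2 / ((1 - cmod (w 0)) / 2)"
      using R R0 w0 by (intro frac_le) (auto simp: field_simps)
    then show "(R + cmod (w 0)) / (R - cmod (w 0)) \<le> 4 / (1 - cmod (w 0))"
      by simp
    show "circle_mean (fun_of_hardy2 h) R \<le> (norm h)\<^sup>2"
      using circle_mean_le_hardy_norm[OF h(2) R0 R(1)] by (simp add: norm_hardy2.rep_eq)
  qed (use w0 in \<open>auto simp: circle_mean_nonneg\<close>)
  also have "\<dots> = (norm h * sqrt (4 / (1 - cmod (w 0))))\<^sup>2"
    using w0 by (simp add: power_mult_distrib)
  finally show ?thesis .
qed

lemma fun_of_hardy2_compose:
  "fun_of_hardy2 (compose_hardy2 w h) = (\<lambda>z. if z \<in> ball 0 1 then fun_of_hardy2 h (w z) else 0)"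
proof -
  have "(\<lambda>z. fun_of_hardy2 h (w z)) holomorphic_on ball 0 1"
    using fun_of_hardy2[of h] norm_self_map_less_1
    by (intro holomorphic_on_compose_gen[OF w, unfolded o_def, of _ "ball 0 1"]) auto
  then have "(\<lambda>z. if z \<in> ball 0 1 then fun_of_hardy2 h (w z) else 0) holomorphic_on ball 0 1"
    by (rule holomorphic_transform) auto
  moreover have "bdd_above (circle_mean
      (\<lambda>z. if z \<in> ball 0 1 then fun_of_hardy2 h (w z) else 0) ` {0..<1})"
    by (intro bdd_aboveI2[OF circle_mean_compose_le]) auto
  ultimately show ?thesis
    unfolding compose_hardy2_def by (intro Abs_hardy2_inverse) auto
qed

lemma bounded_clinear_compose: "bounded_clinear (compose_hardy2 w)"
  unfolding bounded_clinear_def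
proof (intro conjI allI)
  show C: "compose_hardy2 w (c *\<^sub>C f) = c *\<^sub>C compose_hardy2 w f" for c f
    by (rule fun_of_hardy2_inject[THEN iffD1])
      (auto simp: fun_of_hardy2_compose scaleC_hardy2.rep_eq)
  show "bounded_linear (compose_hardy2 w)"
  proof (rule bounded_linear_intro[of _ "sqrt (4 / (1 - cmod (w 0)))"])
    fix f g :: hardy2 and a :: real
    show "compose_hardy2 w (f + g) = compose_hardy2 w f + compose_hardy2 w g"
      by (rule fun_of_hardy2_inject[THEN iffD1])
        (auto simp: fun_of_hardy2_compose plus_hardy2.rep_eq)
    show "compose_hardy2 w (a *\<^sub>R f) = a *\<^sub>R compose_hardy2 w f"
      by (simp add: scaleR_hardy2_def C)
    show "norm (compose_hardy2 w f) \<le> norm f * sqrt (4 / (1 - cmod (w 0)))"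
      unfolding norm_hardy2.rep_eq[of "compose_hardy2 w f"] fun_of_hardy2_compose
      using norm_self_map_less_1[of 0] by (intro hardy_norm_le circle_mean_compose_le) auto
  qed
qed

text \<open>The constant function \<open>1\<close> is fixed by the composition operator.\<close>

lemma compose_hardy2_nonzero: "compose_hardy2 w \<noteq> (\<lambda>_. 0)"
proof -
  let ?one = "\<lambda>z::complex. if z \<in> ball 0 1 then 1 else 0 :: complex"
  have "?one holomorphic_on ball 0 1"
    by (rule holomorphic_transform[of "\<lambda>_. 1"]) auto
  moreover have "bdd_above (circle_mean ?one ` {0..<1})"
    by (intro bdd_aboveI2[of _ _ 1]) (auto simp: circle_mean_def norm_mult)
  ultimately have "fun_of_hardy2 (Abs_hardy2 ?one) = ?one"
    by (intro Abs_hardy2_inverse) auto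
  then have "fun_of_hardy2 (compose_hardy2 w (Abs_hardy2 ?one)) 0 \<noteq> fun_of_hardy2 0 0"
    using norm_self_map_less_1[of 0] by (simp add: fun_of_hardy2_compose zero_hardy2.rep_eq)
  then show ?thesis
    by metis
qed

end

section \<open>Intertwining by a lift\<close>

theorem theorem3p4:
  fixes \<phi> \<psi> :: "complex \<Rightarrow> complex"
  assumes "\<phi> holomorphic_on ball 0 1" and "bounded (\<phi> ` ball 0 1)"
    and "\<psi> holomorphic_on ball 0 1" and "bounded (\<psi> ` ball 0 1)"
    and "covering_space (ball 0 1) \<phi> (\<phi> ` ball 0 1)"
    and "\<psi> ` ball 0 1 \<subseteq> \<phi> ` ball 0 1"
  shows "toeplitz \<phi> \<propto> toeplitz \<psi>"
proof -
  obtain w where w: "w holomorphic_on ball 0 1" "w \<in> ball 0 1 \<rightarrow> ball 0 1"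
    and lift: "\<And>z. z \<in> ball 0 1 \<Longrightarrow> \<phi> (w z) = \<psi> z"
  proof (rule covering_space_lift_holomorphic[OF assms(5) open_ball assms(1,3)])
    show "\<psi> \<in> ball 0 1 \<rightarrow> \<phi> ` ball 0 1"
      using assms(6) by auto
  qed (auto intro: convex_imp_simply_connected convex_imp_locally_path_connected)
  have "compose_hardy2 w \<circ> toeplitz \<phi> = toeplitz \<psi> \<circ> compose_hardy2 w"
  proof (intro ext fun_of_hardy2_inject[THEN iffD1])
    fix h z
    show "fun_of_hardy2 ((compose_hardy2 w \<circ> toeplitz \<phi>) h) z
        = fun_of_hardy2 ((toeplitz \<psi> \<circ> compose_hardy2 w) h) z"
      using lift[of z]
      by (simp add: fun_of_hardy2_compose[OF w] fun_of_hardy2_toeplitz[OF assms(1,2)]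
          fun_of_hardy2_toeplitz[OF assms(3,4)])
  qed
  then show ?thesis
    unfolding intertwined_def
    using bounded_clinear_compose[OF w] compose_hardy2_nonzero[OF w] by blast
qed

end
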